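(* Let $F=\frac1n\sum_{i=1}^n F_i:\mathbb{R}^d\to\mathbb{R}^d$ be $L$-Lipschitz and $\mu$-quasi strongly monotone with respect to a point $x_*$ with $F(x_* )=0$, and let the Expected Residual condition hold with parameter $\delta>0$. Let $\bar\omega:=\min\left\{\frac1{4L},\frac{\mu}{18\delta}\right\}$, $k^*=\left\lceil\frac{4}{\mu\bar\omega}\right\rceil$, and $$\gamma_k=\omega_k:=\begin{cases}\bar\omega,&k\le k^*,\\[2pt] \dfrac{2k+1}{(k+1)^2}\cdot\dfrac2\mu,&k>k^*.\end{cases}$$ Then for all $K\ge k^*$ the SPEG iterates satisfy $$R_K^2\le\left(\frac{k^*}{K}\right)^2\frac{R_0^2}{\exp(2)}+\frac{192\,\sigma_*^2}{\mu^2K},\qquad R_K^2:=\mathbb{E}\left[\|x_K-x_*\|^2+\|x_K-\hat x_{K-1}\|^2\right].$$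
   Context: Stochastic estimator: $v\in\mathbb{R}^n_+$ is a random sampling vector with distribution $\mathcal D$ satisfying $\mathbb{E}_{\mathcal D}[v_i]=1$ for all $i$, and $F_v(x):=\frac1n\sum_{i=1}^n v_iF_i(x)$, so $\mathbb{E}_{\mathcal D}[F_v(x)]=F(x)$. SPEG (Stochastic Past Extragradient): $\hat x_{-1}=x_0$, the vectors $v_{-1},v_0,v_1,\dots$ are i.i.d. from $\mathcal D$, and for $k\ge0$ $$\hat x_k=x_k-\gamma_kF_{v_{k-1}}(\hat x_{k-1}),\qquad x_{k+1}=x_k-\omega_kF_{v_k}(\hat x_k).$$ $\mu$-quasi strongly monotone ($\mu>0$): $\langle F(x),x-x_*\rangle\ge\mu\|x-x_*\|^2$ for all $x$, where $F(x_* )=0$. Expected Residual (ER) condition with parameter $\delta>0$: for all $x$, $\mathbb{E}\left[\|(F_v(x)-F_v(x_* ))-(F(x)-F(x_* ))\|^2\right]\le\frac\delta2\|x-x_*\|^2$. $\sigma_*^2:=\mathbb{E}\|F_v(x_* )\|^2<\infty$. The quantity $R_0^2$ is $R_K^2$ with $K=0$. *)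

theory Defs
  imports "HOL-Probability.Probability"
begin

definition mean_op :: "('n::finite \<Rightarrow> real^'d \<Rightarrow> real^'d) \<Rightarrow> real^'d \<Rightarrow> real^'d" where
  "mean_op Fs x = (1 / real CARD('n)) *\<^sub>R (\<Sum>i\<in>UNIV. Fs i x)"

definition sampled_op :: "('n::finite \<Rightarrow> real^'d \<Rightarrow> real^'d) \<Rightarrow> real^'n \<Rightarrow> real^'d \<Rightarrow> real^'d" where
  "sampled_op Fs v x = (1 / real CARD('n)) *\<^sub>R (\<Sum>i\<in>UNIV. (v $ i) *\<^sub>R Fs i x)"

definition sampling_distribution :: "(real^'n::finite) measure \<Rightarrow> bool" where
  "sampling_distribution D \<longleftrightarrow>
     prob_space D \<and> sets D = sets borel \<and>
     (AE v in D. \<forall>i. 0 \<le> v $ i) \<and>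
     (\<forall>i. integrable D (\<lambda>v. v $ i) \<and> (LINT v|D. v $ i) = 1)"

definition quasi_strongly_monotone :: "real \<Rightarrow> (real^'d \<Rightarrow> real^'d) \<Rightarrow> real^'d \<Rightarrow> bool" where
  "quasi_strongly_monotone \<mu> F xs \<longleftrightarrow>
     0 < \<mu> \<and> F xs = 0 \<and> (\<forall>x. F x \<bullet> (x - xs) \<ge> \<mu> * (norm (x - xs))\<^sup>2)"

text \<open>Integrability is demanded explicitly, because the Bochner integral of a
  non-integrable function is 0 and the bound would then hold for free.\<close>

definition expected_residual ::
  "real \<Rightarrow> (real^'n) measure \<Rightarrow> ('n::finite \<Rightarrow> real^'d \<Rightarrow> real^'d) \<Rightarrow> real^'d \<Rightarrow> bool" where
  "expected_residual \<delta> D Fs xs \<longleftrightarrow>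
     (\<forall>x. integrable D (\<lambda>v. (norm ((sampled_op Fs v x - sampled_op Fs v xs)
                                   - (mean_op Fs x - mean_op Fs xs)))\<^sup>2) \<and>
          (LINT v|D. (norm ((sampled_op Fs v x - sampled_op Fs v xs)
                            - (mean_op Fs x - mean_op Fs xs)))\<^sup>2)
            \<le> \<delta> / 2 * (norm (x - xs))\<^sup>2)"

definition sigma_star2 ::
  "(real^'n) measure \<Rightarrow> ('n::finite \<Rightarrow> real^'d \<Rightarrow> real^'d) \<Rightarrow> real^'d \<Rightarrow> real" where
  "sigma_star2 D Fs xs = (LINT v|D. (norm (sampled_op Fs v xs))\<^sup>2)"

text \<open>The iterates along one realisation \<open>v\<close> of the samples, which are indexed by the integers
  \<open>-1, 0, 1, \<dots>\<close>. The extrapolated points are shifted by one: \<open>speg_prev \<dots> k\<close> is the point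
  \<open>xhat\<close> with index \<open>k - 1\<close>, so that \<open>speg_prev \<dots> 0\<close> is the initial \<open>xhat\<close> with index \<open>-1\<close>.\<close>

fun speg_x :: "('n::finite \<Rightarrow> real^'d \<Rightarrow> real^'d) \<Rightarrow> (nat \<Rightarrow> real) \<Rightarrow> (nat \<Rightarrow> real) \<Rightarrow> real^'d
      \<Rightarrow> (int \<Rightarrow> real^'n) \<Rightarrow> nat \<Rightarrow> real^'d"
  and speg_prev :: "('n::finite \<Rightarrow> real^'d \<Rightarrow> real^'d) \<Rightarrow> (nat \<Rightarrow> real) \<Rightarrow> (nat \<Rightarrow> real) \<Rightarrow> real^'d
      \<Rightarrow> (int \<Rightarrow> real^'n) \<Rightarrow> nat \<Rightarrow> real^'d" where
  "speg_x Fs \<gamma> \<omega> x0 v 0 = x0"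
| "speg_x Fs \<gamma> \<omega> x0 v (Suc k) =
     speg_x Fs \<gamma> \<omega> x0 v k
       - \<omega> k *\<^sub>R sampled_op Fs (v (int k)) (speg_prev Fs \<gamma> \<omega> x0 v (Suc k))"
| "speg_prev Fs \<gamma> \<omega> x0 v 0 = x0"
| "speg_prev Fs \<gamma> \<omega> x0 v (Suc k) =
     speg_x Fs \<gamma> \<omega> x0 v k
       - \<gamma> k *\<^sub>R sampled_op Fs (v (int k - 1)) (speg_prev Fs \<gamma> \<omega> x0 v k)"

text \<open>The random variable whose expectation is \<open>R\<^sub>K\<^sup>2\<close>, on the probability space
  that carries the samples.\<close>

definition speg_error ::
  "('n::finite \<Rightarrow> real^'d \<Rightarrow> real^'d) \<Rightarrow> (nat \<Rightarrow> real) \<Rightarrow> (nat \<Rightarrow> real) \<Rightarrow> real^'d \<Rightarrow> real^'d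
      \<Rightarrow> (int \<Rightarrow> 'w \<Rightarrow> real^'n) \<Rightarrow> nat \<Rightarrow> 'w \<Rightarrow> real" where
  "speg_error Fs \<gamma> \<omega> x0 xs v K s =
     (norm (speg_x Fs \<gamma> \<omega> x0 (\<lambda>k. v k s) K - xs))\<^sup>2
     + (norm (speg_x Fs \<gamma> \<omega> x0 (\<lambda>k. v k s) K - speg_prev Fs \<gamma> \<omega> x0 (\<lambda>k. v k s) K))\<^sup>2"

definition speg_R2 ::
  "'w measure \<Rightarrow> ('n::finite \<Rightarrow> real^'d \<Rightarrow> real^'d) \<Rightarrow> (nat \<Rightarrow> real) \<Rightarrow> (nat \<Rightarrow> real) \<Rightarrow> real^'d
      \<Rightarrow> real^'d \<Rightarrow> (int \<Rightarrow> 'w \<Rightarrow> real^'n) \<Rightarrow> nat \<Rightarrow> real" where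
  "speg_R2 M Fs \<gamma> \<omega> x0 xs v K = (LINT s|M. speg_error Fs \<gamma> \<omega> x0 xs v K s)"

definition omega_bar :: "real \<Rightarrow> real \<Rightarrow> real \<Rightarrow> real" where
  "omega_bar L \<mu> \<delta> = min (1 / (4 * L)) (\<mu> / (18 * \<delta>))"

definition k_star :: "real \<Rightarrow> real \<Rightarrow> real \<Rightarrow> nat" where
  "k_star L \<mu> \<delta> = nat \<lceil>4 / (\<mu> * omega_bar L \<mu> \<delta>)\<rceil>"

definition switching_step :: "real \<Rightarrow> real \<Rightarrow> real \<Rightarrow> nat \<Rightarrow> real" where
  "switching_step L \<mu> \<delta> k =
     (if k \<le> k_star L \<mu> \<delta> then omega_bar L \<mu> \<delta>
      else (2 * real k + 1) / (real k + 1)\<^sup>2 * (2 / \<mu>))"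

end

theory Submission
  imports Defs
begin

text \<open>
  Write \<open>h\<close> for the sampled value at the previous extrapolated point \<open>p\<close>, \<open>g\<close> for the one at
  the new extrapolated point \<open>y\<close>, and \<open>w\<close> for the step size, which is the same in both half
  steps. From the iterate \<open>a\<close> the method moves to \<open>y = a - w h\<close> and then to \<open>a' = a - w g\<close>, so
  \<open>a' - y = w (h - g)\<close>, and expanding squares gives the identity
  \<open>|a' - xs|\<^sup>2 + |a' - y|\<^sup>2 = |a - xs|\<^sup>2 - 2 w (g \<bullet> (y - xs)) + 2 w\<^sup>2 |g - h|\<^sup>2 - |a - y|\<^sup>2\<close>.

  The sample behind \<open>g\<close> is independent of \<open>(a, y)\<close>, so in expectation it may be averaged with
  \<open>(a, y)\<close> held fixed. Then \<open>g\<close> has mean \<open>F y\<close>, quasi strong monotonicity makes the second term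
  at most \<open>- 2 w \<mu> |y - xs|\<^sup>2\<close>, and \<open>|g - h|\<^sup>2\<close> splits into the variance of \<open>g\<close> and \<open>|F y - h|\<^sup>2\<close>;
  the Expected Residual condition bounds the variance by \<open>\<delta> |y - xs|\<^sup>2 + 2 \<sigma>\<^sup>2\<close>. The remaining
  \<open>|F y - h|\<^sup>2\<close> is at most \<open>2 L\<^sup>2 |y - p|\<^sup>2 + 2 |F p - h|\<^sup>2\<close>. Since \<open>y\<close> depends on the sample behind
  \<open>h\<close>, that sample cannot be averaged out of the whole expression, but it can be averaged out of
  the last summand alone, because \<open>p\<close> is older than it. For step sizes
  at most \<open>omega_bar\<close> all terms in \<open>y\<close> and \<open>p\<close> are absorbed, and \<open>one_step_recursion\<close> results:
  \<open>R\<^sub>k\<^sub>+\<^sub>1\<^sup>2 \<le> (1 - w \<mu> / 2) R\<^sub>k\<^sup>2 + 12 w\<^sup>2 \<sigma>\<^sup>2\<close>.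

  The rest concerns real sequences (\<open>switching_rate\<close>). The constant step contracts geometrically,
  and \<open>k\<^sup>*\<close> steps suffice to gain the factor \<open>exp (-2)\<close>, with a noise floor of
  \<open>24 w \<sigma>\<^sup>2 / \<mu>\<close>. The decreasing step is chosen so that \<open>1 - w \<mu> / 2 = k\<^sup>2 / (k + 1)\<^sup>2\<close>;
  hence \<open>k\<^sup>2 R\<^sub>k\<^sup>2\<close> grows by at most \<open>192 \<sigma>\<^sup>2 / \<mu>\<^sup>2\<close> per step, which sums to the \<open>1 / K\<close> rate.
\<close>

section \<open>Second moments\<close>

lemma norm_add_squared_le:
  fixes a b :: "'a::real_inner"
  shows "(norm (a + b))\<^sup>2 \<le> 2 * (norm a)\<^sup>2 + 2 * (norm b)\<^sup>2"
proof -
  have "0 \<le> (norm (a - b))\<^sup>2"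
    by simp
  then show ?thesis
    by (simp add: power2_norm_eq_inner inner_add_left inner_add_right inner_diff_left
        inner_diff_right inner_commute)
qed

lemma integrable_norm_squared_bound:
  fixes X :: "'s \<Rightarrow> 'a::euclidean_space"
  assumes "X \<in> borel_measurable M" and "integrable M g" and "\<And>s. (norm (X s))\<^sup>2 \<le> g s"
  shows "integrable M (\<lambda>s. (norm (X s))\<^sup>2)"
proof (rule Bochner_Integration.integrable_bound[OF assms(2)])
  show "AE s in M. norm ((norm (X s))\<^sup>2) \<le> norm (g s)"
    using order_trans[OF assms(3) abs_ge_self] by simp
qed (use assms(1) in measurable)

lemma integrable_norm_squared_add:
  fixes X Y :: "'s \<Rightarrow> 'a::euclidean_space"
  assumes "X \<in> borel_measurable M" "Y \<in> borel_measurable M"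
    and "integrable M (\<lambda>s. (norm (X s))\<^sup>2)" "integrable M (\<lambda>s. (norm (Y s))\<^sup>2)"
  shows "integrable M (\<lambda>s. (norm (X s + Y s))\<^sup>2)"
  by (rule integrable_norm_squared_bound[where g = "\<lambda>s. 2 * (norm (X s))\<^sup>2 + 2 * (norm (Y s))\<^sup>2"])
    (use assms in \<open>auto intro: norm_add_squared_le\<close>)

lemma integrable_norm_squared_scaleR:
  fixes X :: "'s \<Rightarrow> 'a::euclidean_space"
  assumes "integrable M (\<lambda>s. (norm (X s))\<^sup>2)"
  shows "integrable M (\<lambda>s. (norm (c *\<^sub>R X s))\<^sup>2)"
  using assms by (simp add: power_mult_distrib)

lemma integrable_norm_squared_diff:
  fixes X Y :: "'s \<Rightarrow> 'a::euclidean_space"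
  assumes "X \<in> borel_measurable M" "Y \<in> borel_measurable M"
    and "integrable M (\<lambda>s. (norm (X s))\<^sup>2)" "integrable M (\<lambda>s. (norm (Y s))\<^sup>2)"
  shows "integrable M (\<lambda>s. (norm (X s - Y s))\<^sup>2)"
  using integrable_norm_squared_add[of X M "\<lambda>s. - Y s"] assms by simp

text \<open>By independence the joint law of \<open>(V, X)\<close> is a product, so Tonelli lets \<open>V\<close> be averaged first,
  with \<open>X\<close> frozen. Only an upper bound \<open>b\<close> on the frozen average is kept: for nonnegative \<open>f\<close> its
  integrability already yields that of \<open>f (V, X)\<close>, which is how second moments are propagated
  along the iteration.\<close>

lemma (in prob_space) integral_freezing_le:
  fixes f :: "'b \<Rightarrow> 'b \<Rightarrow> real"
  assumes indep: "indep_var S V N X"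
    and f_meas: "case_prod f \<in> borel_measurable (S \<Otimes>\<^sub>M N)"
    and f_nonneg: "\<And>w x. 0 \<le> f w x"
    and f_integrable: "\<And>x. integrable M (\<lambda>t. f (V t) x)"
    and f_bound: "\<And>x. (\<integral>t. f (V t) x \<partial>M) \<le> b x"
    and b_integrable: "integrable M (\<lambda>s. b (X s))"
  shows "integrable M (\<lambda>s. f (V s) (X s)) \<and> (\<integral>s. f (V s) (X s) \<partial>M) \<le> (\<integral>s. b (X s) \<partial>M)"
proof -
  have V[measurable]: "V \<in> measurable M S" and X[measurable]: "X \<in> measurable M N"
    and joint: "distr M S V \<Otimes>\<^sub>M distr M N X = distr M (S \<Otimes>\<^sub>M N) (\<lambda>s. (V s, X s))"
    using indep unfolding indep_var_distribution_eq by auto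
  interpret V: prob_space "distr M S V"
    by (rule prob_space_distr) fact
  interpret X: prob_space "distr M N X"
    by (rule prob_space_distr) fact
  interpret VX: pair_prob_space "distr M S V" "distr M N X" ..
  note f_meas[measurable]
  have b_nonneg: "0 \<le> b x" for x
    by (rule order_trans[OF Bochner_Integration.integral_nonneg f_bound]) (rule f_nonneg)
  have frozen: "(\<integral>\<^sup>+w. ennreal (f w (X s)) \<partial>distr M S V) \<le> ennreal (b (X s))" if "s \<in> space M" for s
  proof -
    have [measurable]: "(\<lambda>w. f w (X s)) \<in> borel_measurable S"
      using measurable_Pair2[OF f_meas, of "X s"] measurable_space[OF X that] by simp
    have "(\<integral>\<^sup>+w. ennreal (f w (X s)) \<partial>distr M S V) = (\<integral>\<^sup>+t. ennreal (f (V t) (X s)) \<partial>M)"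
      by (subst nn_integral_distr) auto
    also have "\<dots> = ennreal (\<integral>t. f (V t) (X s) \<partial>M)"
      by (rule nn_integral_eq_integral[OF f_integrable]) (simp add: f_nonneg)
    finally show ?thesis
      using f_bound by (simp add: ennreal_leI)
  qed
  have "(\<integral>\<^sup>+s. ennreal (f (V s) (X s)) \<partial>M) =
      (\<integral>\<^sup>+z. ennreal (case_prod f z) \<partial>(distr M S V \<Otimes>\<^sub>M distr M N X))"
    unfolding joint by (subst nn_integral_distr) auto
  also have "\<dots> = (\<integral>\<^sup>+x. \<integral>\<^sup>+w. ennreal (f w x) \<partial>distr M S V \<partial>distr M N X)"
    by (subst VX.nn_integral_snd[symmetric]) auto
  also have "\<dots> = (\<integral>\<^sup>+s. \<integral>\<^sup>+w. ennreal (f w (X s)) \<partial>distr M S V \<partial>M)"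
    by (subst nn_integral_distr) auto
  also have "\<dots> \<le> (\<integral>\<^sup>+s. ennreal (b (X s)) \<partial>M)"
    by (intro nn_integral_mono frozen)
  also have "\<dots> = ennreal (\<integral>s. b (X s) \<partial>M)"
    by (rule nn_integral_eq_integral[OF b_integrable]) (simp add: b_nonneg)
  finally have le: "(\<integral>\<^sup>+s. ennreal (f (V s) (X s)) \<partial>M) \<le> ennreal (\<integral>s. b (X s) \<partial>M)" .
  have int: "integrable M (\<lambda>s. f (V s) (X s))"
    using le f_nonneg by (intro integrableI_nonneg) (auto simp: order_le_less_trans)
  moreover have "(\<integral>s. f (V s) (X s) \<partial>M) \<le> (\<integral>s. b (X s) \<partial>M)"
    using le f_nonneg b_nonneg
    by (subst (asm) nn_integral_eq_integral[OF int]) (auto simp: ennreal_le_iff Bochner_Integration.integral_nonneg)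
  ultimately show ?thesis
    by blast
qed

section \<open>The sampled operator\<close>

locale expected_residual_problem =
  fixes Fs :: "'n::finite \<Rightarrow> real^'d \<Rightarrow> real^'d"
    and D :: "(real^'n) measure"
    and xs :: "real^'d"
    and L \<mu> \<delta> :: real
  assumes Fs_measurable[measurable]: "\<And>i. Fs i \<in> borel_measurable borel"
    and lipschitz: "L-lipschitz_on UNIV (mean_op Fs)"
    and qsm: "quasi_strongly_monotone \<mu> (mean_op Fs) xs"
    and samp: "sampling_distribution D"
    and delta_pos: "0 < \<delta>"
    and ER: "expected_residual \<delta> D Fs xs"
    and sigma_finite: "integrable D (\<lambda>w. (norm (sampled_op Fs w xs))\<^sup>2)"
begin

abbreviation F :: "real^'d \<Rightarrow> real^'d" where "F \<equiv> mean_op Fs"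
abbreviation G :: "real^'n \<Rightarrow> real^'d \<Rightarrow> real^'d" where "G \<equiv> sampled_op Fs"
abbreviation \<sigma>2 :: real where "\<sigma>2 \<equiv> sigma_star2 D Fs xs"
abbreviation noise :: "real^'d \<Rightarrow> real" where "noise y \<equiv> \<delta> * (norm (y - xs))\<^sup>2 + 2 * \<sigma>2"

lemma mu_pos: "0 < \<mu>" and F_root: "F xs = 0"
  and F_monotone: "\<mu> * (norm (y - xs))\<^sup>2 \<le> F y \<bullet> (y - xs)"
  using qsm unfolding quasi_strongly_monotone_def by auto

lemma F_lipschitz: "norm (F x - F y) \<le> L * norm (x - y)"
  using lipschitz_on_normD[OF lipschitz] by simp

lemma F_lipschitz_squared: "(norm (F x - F y))\<^sup>2 \<le> L\<^sup>2 * (norm (x - y))\<^sup>2"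
  using power_mono[OF F_lipschitz[of x y], of 2] by (simp add: power_mult_distrib)

text \<open>Quasi strong monotonicity and Lipschitz continuity are compared at distance 1 from the root.
  In particular \<open>L > 0\<close>, so that \<open>omega_bar\<close> is a genuine positive step size.\<close>

lemma mu_le_L: "\<mu> \<le> L"
proof -
  obtain e :: "real^'d" where e: "norm e = 1"
    using norm_axis_1 by blast
  have "\<mu> \<le> F (xs + e) \<bullet> e"
    using F_monotone[of "xs + e"] e by simp
  also have "\<dots> \<le> norm (F (xs + e) - F xs) * norm e"
    using norm_cauchy_schwarz[of "F (xs + e)" e] by (simp add: F_root)
  also have "\<dots> \<le> L"
    using F_lipschitz[of "xs + e" xs] e by simp
  finally show ?thesis .
qed

lemma F_measurable[measurable]: "F \<in> borel_measurable borel"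
  unfolding mean_op_def by measurable

lemma G_measurable_pair: "(\<lambda>z. G (fst z) (snd z)) \<in> borel_measurable (borel \<Otimes>\<^sub>M borel)"
proof -
  have [measurable]: "(\<lambda>x::real^'n. x $ i) \<in> borel_measurable borel" for i
    by (intro borel_measurable_continuous_onI continuous_intros)
  show ?thesis
    unfolding sampled_op_def by measurable
qed

lemma G_measurable[measurable (raw)]:
  assumes [measurable]: "f \<in> borel_measurable N" "g \<in> borel_measurable N"
  shows "(\<lambda>s. G (f s) (g s)) \<in> borel_measurable N"
proof -
  have "(\<lambda>s. (f s, g s)) \<in> measurable N (borel \<Otimes>\<^sub>M borel)"
    by measurable
  from measurable_compose[OF this G_measurable_pair] show ?thesis
    by simp
qed

lemma sets_D[measurable_cong]: "sets D = sets borel"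
  and prob_space_D: "prob_space D"
  using samp unfolding sampling_distribution_def by auto

lemma sigma_nonneg: "0 \<le> \<sigma>2"
  unfolding sigma_star2_def by simp

lemma G_unbiased:
  "integrable D (\<lambda>w. G w y)" "(\<integral>w. G w y \<partial>D) = F y"
proof -
  have *: "integrable D (\<lambda>w. w $ i)" "(\<integral>w. w $ i \<partial>D) = 1" for i
    using samp unfolding sampling_distribution_def by auto
  show "integrable D (\<lambda>w. G w y)"
    unfolding sampled_op_def using *(1) by auto
  show "(\<integral>w. G w y \<partial>D) = F y"
    unfolding sampled_op_def mean_op_def using * by simp
qed

text \<open>As \<open>F xs = 0\<close>, the deviation of the sample from its mean is the residual bounded by the
  Expected Residual condition plus the sampled value at \<open>xs\<close>, whose second moment is \<open>\<sigma>2\<close>.\<close>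

lemma noise_bound:
  shows noise_integrable: "integrable D (\<lambda>w. (norm (G w y - F y))\<^sup>2)"
    and noise_le: "(\<integral>w. (norm (G w y - F y))\<^sup>2 \<partial>D) \<le> noise y"
proof -
  let ?r = "\<lambda>w. (G w y - G w xs) - (F y - F xs)"
  have r: "integrable D (\<lambda>w. (norm (?r w))\<^sup>2)" "(\<integral>w. (norm (?r w))\<^sup>2 \<partial>D) \<le> \<delta> / 2 * (norm (y - xs))\<^sup>2"
    using ER unfolding expected_residual_def by auto
  let ?g = "\<lambda>w. 2 * (norm (?r w))\<^sup>2 + 2 * (norm (G w xs))\<^sup>2"
  have le: "(norm (G w y - F y))\<^sup>2 \<le> ?g w" for w
    using norm_add_squared_le[of "?r w" "G w xs"] by (simp add: F_root)
  have g: "integrable D ?g"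
    using r(1) sigma_finite by simp
  show int: "integrable D (\<lambda>w. (norm (G w y - F y))\<^sup>2)"
    by (rule integrable_norm_squared_bound[OF _ g le]) measurable
  have "(\<integral>w. (norm (G w y - F y))\<^sup>2 \<partial>D) \<le> integral\<^sup>L D ?g"
    by (rule integral_mono[OF int g le])
  also have "\<dots> = 2 * (\<integral>w. (norm (?r w))\<^sup>2 \<partial>D) + 2 * \<sigma>2"
    using r(1) sigma_finite by (simp add: sigma_star2_def)
  also have "\<dots> \<le> noise y"
    using r(2) by simp
  finally show "(\<integral>w. (norm (G w y - F y))\<^sup>2 \<partial>D) \<le> noise y" .
qed

text \<open>An upper bound for the expected next error when the iterate \<open>a\<close> and the extrapolated point \<open>y\<close>
  are held fixed and only the new sample is random. The vector \<open>a - y\<close> stands for \<open>w\<close> times the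
  past sampled value, so the pair \<open>(a, y)\<close> is all that the bound needs to know about the past.\<close>

definition frozen_step_bound :: "real \<Rightarrow> real^'d \<Rightarrow> real^'d \<Rightarrow> real" where
  "frozen_step_bound w a y = (norm (a - xs))\<^sup>2 - 2 * w * \<mu> * (norm (y - xs))\<^sup>2 + 2 * w\<^sup>2 * noise y
     + 2 * (norm (w *\<^sub>R F y - (a - y)))\<^sup>2 - (norm (a - y))\<^sup>2"

text \<open>With \<open>q = w F y - (a - y)\<close> the error splits into a constant, a part linear in the sampled value,
  whose mean is known, and \<open>2 w\<^sup>2\<close> times the squared deviation from the mean.\<close>

lemma frozen_step:
  fixes a y :: "real^'d"
  assumes "0 \<le> w"
  defines "e \<equiv> \<lambda>u. (norm (a - w *\<^sub>R G u y - xs))\<^sup>2 + (norm (a - w *\<^sub>R G u y - y))\<^sup>2"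
  shows "integrable D e" and "(\<integral>u. e u \<partial>D) \<le> frozen_step_bound w a y"
proof -
  interpret D: prob_space D by (rule prob_space_D)
  define q where "q = w *\<^sub>R F y - (a - y)"
  let ?c = "(norm (a - xs))\<^sup>2 + 2 * (norm q)\<^sup>2 - (norm (a - y))\<^sup>2 - 4 * w * (F y \<bullet> q)"
  let ?l = "\<lambda>u. 4 * w * (G u y \<bullet> q) - 2 * w * (G u y \<bullet> (y - xs))"
  let ?n = "\<lambda>u. 2 * w\<^sup>2 * (norm (G u y - F y))\<^sup>2"
  have e: "e = (\<lambda>u. ?c + ?l u + ?n u)"
    unfolding e_def q_def
    by (rule ext, unfold power2_norm_eq_inner)
      (simp add: inner_add_left inner_add_right inner_diff_left inner_diff_right inner_commute
        algebra_simps power2_eq_square)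
  have int: "integrable D ?l" "integrable D ?n"
    using G_unbiased(1)[of y] noise_integrable[of y] by auto
  show "integrable D e"
    unfolding e using int by simp
  have "(\<integral>u. ?l u \<partial>D) = 4 * w * (F y \<bullet> q) - 2 * w * (F y \<bullet> (y - xs))"
    using G_unbiased[of y] by simp
  moreover have "(\<integral>u. ?n u \<partial>D) \<le> 2 * w\<^sup>2 * noise y"
    using noise_le[of y] by (simp add: mult_left_mono)
  moreover have "2 * w * (\<mu> * (norm (y - xs))\<^sup>2) \<le> 2 * w * (F y \<bullet> (y - xs))"
    using F_monotone[of y] assms(1) by (intro mult_left_mono) auto
  moreover have "(\<integral>u. e u \<partial>D) = ?c + (\<integral>u. ?l u \<partial>D) + (\<integral>u. ?n u \<partial>D)"
    unfolding e using int by (simp add: D.prob_space)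
  ultimately show "(\<integral>u. e u \<partial>D) \<le> frozen_step_bound w a y"
    unfolding frozen_step_bound_def q_def by (simp add: algebra_simps)
qed

lemma omega_bar_pos: "0 < omega_bar L \<mu> \<delta>"
  using mu_pos mu_le_L delta_pos unfolding omega_bar_def by simp

lemma step_size_bounds:
  assumes "0 < w" "w \<le> omega_bar L \<mu> \<delta>"
  shows "w * L \<le> 1 / 4" "w * \<delta> \<le> \<mu> / 18" "w * \<mu> \<le> 1 / 4"
proof -
  have L: "0 < L"
    using mu_pos mu_le_L by simp
  have "w \<le> 1 / (4 * L)" "w \<le> \<mu> / (18 * \<delta>)"
    using assms(2) unfolding omega_bar_def by auto
  then show "w * L \<le> 1 / 4" "w * \<delta> \<le> \<mu> / 18"
    using L delta_pos by (auto simp: field_simps)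
  moreover have "w * \<mu> \<le> w * L"
    using mu_le_L assms(1) by simp
  ultimately show "w * \<mu> \<le> 1 / 4"
    by simp
qed

text \<open>When \<open>h\<close> is the value at \<open>p\<close> of a sample independent of \<open>p\<close>, the correction term on the left has
  nonnegative expectation by \<open>noise_bound\<close>, so adding it inside the expectation is free, while it
  makes the inequality true pointwise. The proof is linear in the squared distances and their
  multiples by \<open>w \<mu>\<close>. The constant \<open>18\<close> in \<open>omega_bar\<close> is exactly what yields the factor \<open>1 - w \<mu> / 2\<close>:
  the coefficient of \<open>|a - xs|\<^sup>2\<close> becomes \<open>1 - 17/18 w \<mu> + 4/9 w \<mu>\<close>.\<close>

lemma frozen_step_contraction:
  assumes w: "0 < w" "w \<le> omega_bar L \<mu> \<delta>" and h: "a - y = w *\<^sub>R h"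
  shows "frozen_step_bound w a y + 4 * w\<^sup>2 * (noise p - (norm (h - F p))\<^sup>2)
    \<le> (1 - w * \<mu> / 2) * ((norm (a - xs))\<^sup>2 + (norm (a - p))\<^sup>2) + 12 * w\<^sup>2 * \<sigma>2"
proof -
  define c where "c = w * \<mu>"
  define A Y P Q S T H where "A = (norm (a - xs))\<^sup>2" and "Y = (norm (y - xs))\<^sup>2"
    and "P = (norm (p - xs))\<^sup>2" and "Q = (norm (y - p))\<^sup>2" and "S = (norm (a - y))\<^sup>2"
    and "T = (norm (a - p))\<^sup>2" and "H = (norm (h - F p))\<^sup>2"
  note defs = A_def Y_def P_def Q_def S_def T_def H_def
  note step = step_size_bounds[OF w]
  have c: "0 < c" "c \<le> 1 / 4"
    using w(1) mu_pos step(3) by (auto simp: c_def)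
  have nonneg: "0 \<le> Y" "0 \<le> P" "0 \<le> Q" "0 \<le> S" "0 \<le> T"
    by (auto simp: defs)
  have Q: "Q \<le> 2 * S + 2 * T"
    using norm_add_squared_le[of "y - a" "a - p"] by (simp add: defs norm_minus_commute)
  have P: "P \<le> 2 * T + 2 * A"
    using norm_add_squared_le[of "p - a" "a - xs"] by (simp add: defs norm_minus_commute)
  have A: "A \<le> 2 * S + 2 * Y"
    using norm_add_squared_le[of "a - y" "y - xs"] by (simp add: defs)
  have w\<delta>: "w\<^sup>2 * \<delta> \<le> c / 18"
    using mult_left_mono[OF step(2), of w] w(1) by (simp add: c_def power2_eq_square algebra_simps)
  have wL: "w\<^sup>2 * L\<^sup>2 \<le> 1 / 16"
    using power_mono[OF step(1), of 2] w(1) mu_pos mu_le_L by (simp add: power_mult_distrib power_divide)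
  \<comment> \<open>The past value \<open>h\<close> is compared with \<open>F y\<close> by way of its conditional mean \<open>F p\<close>.\<close>
  have "(norm (w *\<^sub>R F y - (a - y)))\<^sup>2 = w\<^sup>2 * (norm ((F y - F p) + (F p - h)))\<^sup>2"
    by (simp add: h scaleR_diff_right[symmetric] power_mult_distrib)
  also have "\<dots> \<le> w\<^sup>2 * (2 * (L\<^sup>2 * Q) + 2 * H)"
  proof (rule mult_left_mono)
    show "(norm ((F y - F p) + (F p - h)))\<^sup>2 \<le> 2 * (L\<^sup>2 * Q) + 2 * H"
      using norm_add_squared_le[of "F y - F p" "F p - h"] F_lipschitz_squared[of y p]
      by (simp add: defs norm_minus_commute)
  qed simp
  finally have past: "(norm (w *\<^sub>R F y - (a - y)))\<^sup>2 \<le> 2 * (w\<^sup>2 * L\<^sup>2 * Q) + 2 * (w\<^sup>2 * H)"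
    by (simp add: algebra_simps)
  have "w\<^sup>2 * \<delta> * Y \<le> c / 18 * Y" "w\<^sup>2 * \<delta> * P \<le> c / 18 * P" "w\<^sup>2 * L\<^sup>2 * Q \<le> 1 / 16 * Q"
    by (rule mult_right_mono, use w\<delta> wL nonneg in simp, use nonneg in simp)+
  moreover have "c * A \<le> 2 * (c * S) + 2 * (c * Y)" "c * P \<le> 2 * (c * T) + 2 * (c * A)"
    using mult_left_mono[OF A, of c] mult_left_mono[OF P, of c] c by (simp_all add: algebra_simps)
  moreover have "c * S \<le> 1 / 4 * S" "c * T \<le> 1 / 4 * T"
    by (rule mult_right_mono, use c nonneg in simp, use nonneg in simp)+
  moreover have "(1 - c / 2) * (A + T) = A + T - c * A / 2 - c * T / 2"
    by (simp add: algebra_simps)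
  ultimately have "A - 2 * c * Y + 2 * (w\<^sup>2 * \<delta> * Y) + 4 * (w\<^sup>2 * L\<^sup>2 * Q) - S + 4 * (w\<^sup>2 * \<delta> * P)
      \<le> (1 - c / 2) * (A + T)"
    using Q nonneg by linarith
  then have "A - 2 * c * Y + 2 * (w\<^sup>2 * \<delta> * Y) + 2 * (norm (w *\<^sub>R F y - (a - y)))\<^sup>2 - S
        + 4 * (w\<^sup>2 * \<delta> * P) - 4 * (w\<^sup>2 * H) + 12 * w\<^sup>2 * \<sigma>2
      \<le> (1 - c / 2) * (A + T) + 12 * w\<^sup>2 * \<sigma>2"
    using past by linarith
  moreover have "frozen_step_bound w a y + 4 * w\<^sup>2 * (noise p - (norm (h - F p))\<^sup>2)
      = A - 2 * c * Y + 2 * (w\<^sup>2 * \<delta> * Y) + 2 * (norm (w *\<^sub>R F y - (a - y)))\<^sup>2 - S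
        + 4 * (w\<^sup>2 * \<delta> * P) - 4 * (w\<^sup>2 * H) + 12 * w\<^sup>2 * \<sigma>2"
    unfolding frozen_step_bound_def defs c_def by (simp add: algebra_simps)
  moreover have "(1 - w * \<mu> / 2) * ((norm (a - xs))\<^sup>2 + (norm (a - p))\<^sup>2) = (1 - c / 2) * (A + T)"
    by (simp only: defs c_def)
  ultimately show ?thesis
    by (simp only:)
qed

end

section \<open>Independence along a run\<close>

text \<open>The recursion is unfolded only on demand, since each unfolding duplicates the whole past.\<close>

declare speg_x.simps(2) [simp del] speg_prev.simps(2) [simp del]

lemma speg_cong:
  assumes "\<And>j. -1 \<le> j \<Longrightarrow> j < int k \<Longrightarrow> u j = u' j"
  shows "speg_x Fs \<gamma> \<omega> x0 u k = speg_x Fs \<gamma> \<omega> x0 u' k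
    \<and> speg_prev Fs \<gamma> \<omega> x0 u (Suc k) = speg_prev Fs \<gamma> \<omega> x0 u' (Suc k)"
  using assms
proof (induction k)
  case (Suc k)
  then have "speg_x Fs \<gamma> \<omega> x0 u (Suc k) = speg_x Fs \<gamma> \<omega> x0 u' (Suc k)"
    by (simp add: speg_x.simps(2))
  with Suc show ?case
    by (simp add: speg_prev.simps(2)[of _ _ _ _ _ "Suc k"])
qed (simp add: speg_prev.simps(2))

lemma speg_prev_cong:
  assumes "\<And>j. -1 \<le> j \<Longrightarrow> j < int k - 1 \<Longrightarrow> u j = u' j"
  shows "speg_prev Fs \<gamma> \<omega> x0 u k = speg_prev Fs \<gamma> \<omega> x0 u' k"
  using assms speg_cong[of "k - 1" u u' Fs \<gamma> \<omega> x0] by (cases k) auto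

lemma (in expected_residual_problem) speg_measurable:
  assumes "\<And>j. -1 \<le> j \<Longrightarrow> j < int k \<Longrightarrow> u j \<in> borel_measurable N"
  shows "(\<lambda>s. speg_x Fs \<gamma> \<omega> x0 (\<lambda>j. u j s) k) \<in> borel_measurable N
    \<and> (\<lambda>s. speg_prev Fs \<gamma> \<omega> x0 (\<lambda>j. u j s) (Suc k)) \<in> borel_measurable N"
  using assms
proof (induction k)
  case 0
  then have [measurable]: "u (-1) \<in> borel_measurable N"
    by simp
  show ?case
    by (simp add: speg_prev.simps(2))
next
  case (Suc k)
  let ?X = "\<lambda>k s. speg_x Fs \<gamma> \<omega> x0 (\<lambda>j. u j s) k"
  let ?P = "\<lambda>k s. speg_prev Fs \<gamma> \<omega> x0 (\<lambda>j. u j s) k"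
  have [measurable]: "?X k \<in> borel_measurable N" "?P (Suc k) \<in> borel_measurable N"
    "u (int k) \<in> borel_measurable N"
    using Suc by auto
  have X: "?X (Suc k) = (\<lambda>s. ?X k s - \<omega> k *\<^sub>R G (u (int k) s) (?P (Suc k) s))"
    by (rule ext) (rule speg_x.simps(2))
  have 1[measurable]: "?X (Suc k) \<in> borel_measurable N"
    unfolding X by measurable
  have "?P (Suc (Suc k)) = (\<lambda>s. ?X (Suc k) s - \<gamma> (Suc k) *\<^sub>R G (u (int k) s) (?P (Suc k) s))"
    by (rule ext) (subst speg_prev.simps(2), simp)
  then have "?P (Suc (Suc k)) \<in> borel_measurable N"
    by (rule ssubst) measurable
  with 1 show ?case
    by blast
qed

lemma (in expected_residual_problem) speg_prev_measurable:
  assumes "\<And>j. -1 \<le> j \<Longrightarrow> j < int k - 1 \<Longrightarrow> u j \<in> borel_measurable N"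
  shows "(\<lambda>s. speg_prev Fs \<gamma> \<omega> x0 (\<lambda>j. u j s) k) \<in> borel_measurable N"
proof (cases k)
  case (Suc m)
  with assms speg_measurable[of m u N \<gamma> \<omega> x0] show ?thesis
    by auto
qed simp

section \<open>The one-step recursion\<close>

locale speg_run = expected_residual_problem Fs D xs L \<mu> \<delta> + prob_space M
  for Fs :: "'n::finite \<Rightarrow> real^'d \<Rightarrow> real^'d" and D xs L \<mu> \<delta> and M :: "'w measure" +
  fixes v :: "int \<Rightarrow> 'w \<Rightarrow> real^'n" and x0 :: "real^'d" and \<eta> :: "nat \<Rightarrow> real"
  assumes indep: "indep_vars (\<lambda>_. borel) v {-1..}"
    and distr_v: "\<And>k. -1 \<le> k \<Longrightarrow> distr M borel (v k) = D"
    and step_pos: "\<And>k. 0 < \<eta> k"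
    and step_le: "\<And>k. \<eta> k \<le> omega_bar L \<mu> \<delta>"
begin

abbreviation X :: "nat \<Rightarrow> 'w \<Rightarrow> real^'d" where
  "X k s \<equiv> speg_x Fs \<eta> \<eta> x0 (\<lambda>k. v k s) k"
abbreviation P :: "nat \<Rightarrow> 'w \<Rightarrow> real^'d" where
  "P k s \<equiv> speg_prev Fs \<eta> \<eta> x0 (\<lambda>k. v k s) k"
abbreviation err :: "nat \<Rightarrow> 'w \<Rightarrow> real" where
  "err \<equiv> speg_error Fs \<eta> \<eta> x0 xs v"
abbreviation R2 :: "nat \<Rightarrow> real" where
  "R2 \<equiv> speg_R2 M Fs \<eta> \<eta> x0 xs v"

lemma v_measurable: "-1 \<le> k \<Longrightarrow> v k \<in> borel_measurable M"
  using indep unfolding indep_vars_def by auto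

lemma X_measurable[measurable]: "X k \<in> borel_measurable M"
  and P_measurable[measurable]: "P k \<in> borel_measurable M"
  using speg_measurable[of k v M \<eta> \<eta> x0] speg_prev_measurable[of k v M \<eta> \<eta> x0] v_measurable
  by auto

text \<open>The sample with index \<open>j\<close> may be averaged first in any expression whose other argument is a
  function \<open>\<Phi>\<close> of the samples with smaller indices. The hypothesis on \<open>restrict\<close> says that \<open>\<Phi>\<close>
  sees only those.\<close>

lemma fresh_sample_le:
  fixes f :: "real^'n \<Rightarrow> 'c \<Rightarrow> real" and \<Phi> :: "(int \<Rightarrow> real^'n) \<Rightarrow> 'c"
  assumes j: "-1 \<le> j"
    and past: "\<And>u. \<Phi> (restrict u {-1..<j}) = \<Phi> u"
    and \<Phi>_meas: "\<Phi> \<in> measurable (PiM {-1..<j} (\<lambda>_. borel)) N"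
    and f_meas: "case_prod f \<in> borel_measurable (borel \<Otimes>\<^sub>M N)"
    and f_nonneg: "\<And>w x. 0 \<le> f w x"
    and f_integrable: "\<And>x. integrable D (\<lambda>w. f w x)"
    and f_bound: "\<And>x. (\<integral>w. f w x \<partial>D) \<le> b x"
    and b_integrable: "integrable M (\<lambda>s. b (\<Phi> (\<lambda>i. v i s)))"
  shows "integrable M (\<lambda>s. f (v j s) (\<Phi> (\<lambda>i. v i s)))
    \<and> (\<integral>s. f (v j s) (\<Phi> (\<lambda>i. v i s)) \<partial>M) \<le> (\<integral>s. b (\<Phi> (\<lambda>i. v i s)) \<partial>M)"
proof -
  let ?V = "\<lambda>s. restrict (\<lambda>i. v i s) {j}" and ?U = "\<lambda>s. restrict (\<lambda>i. v i s) {-1..<j}"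
  let ?f = "\<lambda>r u. f (r j) (\<Phi> u)"
  have ind: "indep_var (PiM {j} (\<lambda>_. borel)) ?V (PiM {-1..<j} (\<lambda>_. borel)) ?U"
    using j by (intro indep_var_restrict[OF indep]) auto
  have [measurable]: "(\<lambda>r. r j) \<in> measurable (PiM {j} (\<lambda>_. borel :: (real^'n) measure)) borel"
    by (rule measurable_component_singleton) simp
  note \<Phi>_meas[measurable]
  have "(\<lambda>z. (fst z j, \<Phi> (snd z))) \<in>
      measurable (PiM {j} (\<lambda>_. borel) \<Otimes>\<^sub>M PiM {-1..<j} (\<lambda>_. borel)) (borel \<Otimes>\<^sub>M N)"
    by measurable
  from measurable_compose[OF this f_meas]
  have meas: "case_prod ?f \<in> borel_measurable (PiM {j} (\<lambda>_. borel) \<Otimes>\<^sub>M PiM {-1..<j} (\<lambda>_. borel))"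
    by (simp add: case_prod_beta')
  have D: "D = distr M borel (v j)"
    using distr_v[OF j] by simp
  note v_measurable[OF j, measurable]
  have f_int: "integrable M (\<lambda>t. f (v j t) x)" "(\<integral>t. f (v j t) x \<partial>M) \<le> b x" for x
  proof -
    have [measurable]: "(\<lambda>w. f w x) \<in> borel_measurable borel"
      using borel_measurable_integrable[OF f_integrable[of x]] by simp
    show "integrable M (\<lambda>t. f (v j t) x)"
      using f_integrable[of x] unfolding D by (subst (asm) integrable_distr_eq) auto
    show "(\<integral>t. f (v j t) x \<partial>M) \<le> b x"
      using f_bound[of x] unfolding D by (subst (asm) integral_distr) auto
  qed
  have "integrable M (\<lambda>s. ?f (?V s) (?U s)) \<and>
      (\<integral>s. ?f (?V s) (?U s) \<partial>M) \<le> (\<integral>s. b (\<Phi> (?U s)) \<partial>M)"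
    by (rule integral_freezing_le[OF ind meas, where b = "\<lambda>u. b (\<Phi> u)"])
      (simp_all add: f_nonneg f_int[simplified] b_integrable past del: restrict_apply, simp_all add: f_int)
  then show ?thesis
    by (simp add: past)
qed

text \<open>The point \<open>P k\<close> is determined by samples with index below \<open>k - 1\<close>, hence is independent of the
  sample with which the operator is evaluated there.\<close>

lemma past_noise:
  assumes "integrable M (\<lambda>s. (norm (P k s - xs))\<^sup>2)"
  shows "integrable M (\<lambda>s. (norm (G (v (int k - 1) s) (P k s) - F (P k s)))\<^sup>2)"
    and "(\<integral>s. (norm (G (v (int k - 1) s) (P k s) - F (P k s)))\<^sup>2 \<partial>M) \<le> (\<integral>s. noise (P k s) \<partial>M)"
proof -
  have meas: "(\<lambda>u. speg_prev Fs \<eta> \<eta> x0 u k) \<in> borel_measurable (PiM {-1..<int k - 1} (\<lambda>_. borel))"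
    using speg_prev_measurable[of k "\<lambda>j u. u j" "PiM {-1..<int k - 1} (\<lambda>_. borel)" \<eta> \<eta> x0] by simp
  have "integrable M (\<lambda>s. (norm (G (v (int k - 1) s) (P k s) - F (P k s)))\<^sup>2)
    \<and> (\<integral>s. (norm (G (v (int k - 1) s) (P k s) - F (P k s)))\<^sup>2 \<partial>M) \<le> (\<integral>s. noise (P k s) \<partial>M)"
  proof (rule fresh_sample_le[where f = "\<lambda>w y. (norm (G w y - F y))\<^sup>2" and b = noise
        and \<Phi> = "\<lambda>u. speg_prev Fs \<eta> \<eta> x0 u k", OF _ _ meas])
    show "speg_prev Fs \<eta> \<eta> x0 (restrict u {-1..<int k - 1}) k = speg_prev Fs \<eta> \<eta> x0 u k" for u
      by (rule speg_prev_cong) simp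
    show "(\<lambda>(w, y). (norm (G w y - F y))\<^sup>2) \<in> borel_measurable (borel \<Otimes>\<^sub>M borel)"
      by measurable
  qed (use noise_integrable noise_le assms in auto)
  then show "integrable M (\<lambda>s. (norm (G (v (int k - 1) s) (P k s) - F (P k s)))\<^sup>2)"
    and "(\<integral>s. (norm (G (v (int k - 1) s) (P k s) - F (P k s)))\<^sup>2 \<partial>M) \<le> (\<integral>s. noise (P k s) \<partial>M)"
    by auto
qed

lemma frozen_step_bound_integrable:
  assumes "integrable M (\<lambda>s. (norm (X k s - xs))\<^sup>2)" "integrable M (\<lambda>s. (norm (P m s - xs))\<^sup>2)"
  shows "integrable M (\<lambda>s. frozen_step_bound w (X k s) (P m s))"
proof -
  have diff: "integrable M (\<lambda>s. (norm (X k s - P m s))\<^sup>2)"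
    using integrable_norm_squared_diff[OF _ _ assms] by simp
  have "integrable M (\<lambda>s. (norm (F (P m s)))\<^sup>2)"
    by (rule integrable_norm_squared_bound[where g = "\<lambda>s. L\<^sup>2 * (norm (P m s - xs))\<^sup>2"])
      (use assms F_lipschitz_squared[of _ xs] in \<open>auto simp: F_root\<close>)
  from integrable_norm_squared_diff[OF _ _ integrable_norm_squared_scaleR[OF this, of w] diff]
  have "integrable M (\<lambda>s. (norm (w *\<^sub>R F (P m s) - (X k s - P m s)))\<^sup>2)"
    by simp
  with assms diff show ?thesis
    unfolding frozen_step_bound_def by simp
qed

text \<open>Both \<open>X k\<close> and \<open>P (Suc k)\<close> are determined by samples with index below \<open>k\<close>.\<close>

lemma fresh_step:
  assumes "integrable M (\<lambda>s. (norm (X k s - xs))\<^sup>2)" "integrable M (\<lambda>s. (norm (P (Suc k) s - xs))\<^sup>2)"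
  shows "integrable M (err (Suc k))"
    and "R2 (Suc k) \<le> (\<integral>s. frozen_step_bound (\<eta> k) (X k s) (P (Suc k) s) \<partial>M)"
proof -
  let ?w = "\<eta> k"
  let ?f = "\<lambda>u (a, y). (norm (a - ?w *\<^sub>R G u y - xs))\<^sup>2 + (norm (a - ?w *\<^sub>R G u y - y))\<^sup>2"
  let ?\<Phi> = "\<lambda>u. (speg_x Fs \<eta> \<eta> x0 u k, speg_prev Fs \<eta> \<eta> x0 u (Suc k))"
  have err: "err (Suc k) = (\<lambda>s. ?f (v (int k) s) (?\<Phi> (\<lambda>i. v i s)))"
    unfolding speg_error_def speg_x.simps(2) by (rule ext) simp
  have "?\<Phi> \<in> measurable (PiM {-1..<int k} (\<lambda>_. borel)) (borel \<Otimes>\<^sub>M borel)"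
    using speg_measurable[of k "\<lambda>j u. u j" "PiM {-1..<int k} (\<lambda>_. borel)" \<eta> \<eta> x0]
    by (intro measurable_Pair) auto
  then have "integrable M (\<lambda>s. ?f (v (int k) s) (?\<Phi> (\<lambda>i. v i s))) \<and>
    (\<integral>s. ?f (v (int k) s) (?\<Phi> (\<lambda>i. v i s)) \<partial>M)
      \<le> (\<integral>s. (\<lambda>(a, y). frozen_step_bound ?w a y) (?\<Phi> (\<lambda>i. v i s)) \<partial>M)"
  proof (rule fresh_sample_le[rotated 2])
    show "?\<Phi> (restrict u {-1..<int k}) = ?\<Phi> u" for u
      using speg_cong[of k "restrict u {-1..<int k}" u Fs \<eta> \<eta> x0]
      by auto
    show "case_prod ?f \<in> borel_measurable (borel \<Otimes>\<^sub>M (borel \<Otimes>\<^sub>M borel))"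
      unfolding case_prod_beta' by measurable
    show "integrable M (\<lambda>s. (\<lambda>(a, y). frozen_step_bound ?w a y) (?\<Phi> (\<lambda>i. v i s)))"
      using frozen_step_bound_integrable[OF assms, of ?w] by simp
  qed (use frozen_step[of ?w] step_pos[of k] in \<open>auto split: prod.splits simp: less_imp_le\<close>)
  then show "integrable M (err (Suc k))"
    and "R2 (Suc k) \<le> (\<integral>s. frozen_step_bound (\<eta> k) (X k s) (P (Suc k) s) \<partial>M)"
    unfolding speg_R2_def err by auto
qed

lemma P_Suc: "P (Suc k) s = X k s - \<eta> k *\<^sub>R G (v (int k - 1) s) (P k s)"
  by (rule speg_prev.simps(2))

lemma P_Suc_integrable:
  assumes "integrable M (\<lambda>s. (norm (X k s - xs))\<^sup>2)" "integrable M (\<lambda>s. (norm (P k s - xs))\<^sup>2)"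
  shows "integrable M (\<lambda>s. (norm (P (Suc k) s - xs))\<^sup>2)"
proof -
  let ?H = "\<lambda>s. G (v (int k - 1) s) (P k s)"
  have [measurable]: "v (int k - 1) \<in> borel_measurable M"
    by (rule v_measurable) simp
  have "integrable M (\<lambda>s. (norm (F (P k s)))\<^sup>2)"
    by (rule integrable_norm_squared_bound[where g = "\<lambda>s. L\<^sup>2 * (norm (P k s - xs))\<^sup>2"])
      (use assms F_lipschitz_squared[of _ xs] in \<open>auto simp: F_root\<close>)
  from integrable_norm_squared_add[OF _ _ past_noise(1)[OF assms(2)] this]
  have "integrable M (\<lambda>s. (norm (?H s))\<^sup>2)"
    by simp
  from integrable_norm_squared_diff[OF _ _ assms(1) integrable_norm_squared_scaleR[OF this, of "\<eta> k"]]
  show ?thesis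
    unfolding P_Suc by (simp add: algebra_simps)
qed

text \<open>Square integrability passes from \<open>(X k, P k)\<close> first to \<open>P (Suc k)\<close>, through the noise bound at
  the past point, and then to \<open>X (Suc k)\<close>, whose distance to \<open>xs\<close> is part of the next error.\<close>

lemma second_moments:
  "integrable M (\<lambda>s. (norm (X k s - xs))\<^sup>2) \<and> integrable M (\<lambda>s. (norm (P k s - xs))\<^sup>2)"
proof (induction k)
  case (Suc k)
  then have P: "integrable M (\<lambda>s. (norm (P (Suc k) s - xs))\<^sup>2)"
    by (intro P_Suc_integrable) auto
  have "integrable M (err (Suc k))"
    using Suc P by (intro fresh_step) auto
  then have "integrable M (\<lambda>s. (norm (X (Suc k) s - xs))\<^sup>2)"
    by (rule integrable_norm_squared_bound[rotated])
      (use X_measurable[of "Suc k"] in \<open>auto simp: speg_error_def\<close>)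
  with P show ?case
    by blast
qed simp

lemma err_integrable: "integrable M (err k)"
proof -
  have "integrable M (\<lambda>s. (norm (X k s - P k s))\<^sup>2)"
    using integrable_norm_squared_diff[OF _ _ conjunct1[OF second_moments[of k]]
        conjunct2[OF second_moments[of k]]] by simp
  with second_moments[of k] show ?thesis
    unfolding speg_error_def by simp
qed

lemma R2_nonneg: "0 \<le> R2 k"
  unfolding speg_R2_def speg_error_def by simp

lemma one_step_recursion:
  "R2 (Suc k) \<le> (1 - \<eta> k * \<mu> / 2) * R2 k + 12 * (\<eta> k)\<^sup>2 * \<sigma>2"
proof -
  let ?w = "\<eta> k"
  let ?N = "\<lambda>s. (norm (G (v (int k - 1) s) (P k s) - F (P k s)))\<^sup>2"
  let ?B = "\<lambda>s. frozen_step_bound ?w (X k s) (P (Suc k) s)"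
  note moments = second_moments[of k, THEN conjunct1] second_moments[of k, THEN conjunct2]
    second_moments[of "Suc k", THEN conjunct2]
  have int: "integrable M ?B" "integrable M ?N" "integrable M (\<lambda>s. noise (P k s))"
    using frozen_step_bound_integrable[OF moments(1,3)] past_noise(1)[OF moments(2)] moments(2)
    by simp_all
  have pointwise: "?B s + 4 * ?w\<^sup>2 * (noise (P k s) - ?N s)
      \<le> (1 - ?w * \<mu> / 2) * err k s + 12 * ?w\<^sup>2 * \<sigma>2" for s
    unfolding speg_error_def
    by (rule frozen_step_contraction[OF step_pos step_le]) (simp add: P_Suc)
  have "R2 (Suc k) \<le> (\<integral>s. ?B s \<partial>M)"
    by (rule fresh_step(2)[OF moments(1,3)])
  also have "\<dots> \<le> (\<integral>s. ?B s \<partial>M) + 4 * ?w\<^sup>2 * ((\<integral>s. noise (P k s) \<partial>M) - (\<integral>s. ?N s \<partial>M))"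
    using past_noise(2)[OF moments(2)] by simp
  also have "\<dots> = (\<integral>s. ?B s + 4 * ?w\<^sup>2 * (noise (P k s) - ?N s) \<partial>M)"
    using int by simp
  also have "\<dots> \<le> (\<integral>s. (1 - ?w * \<mu> / 2) * err k s + 12 * ?w\<^sup>2 * \<sigma>2 \<partial>M)"
    by (rule integral_mono[OF _ _ pointwise])
      (use int err_integrable[of k] in \<open>auto\<close>)
  also have "\<dots> = (1 - ?w * \<mu> / 2) * R2 k + 12 * ?w\<^sup>2 * \<sigma>2"
    using err_integrable[of k] by (simp add: speg_R2_def prob_space)
  finally show ?thesis .
qed

end

section \<open>The switching step size\<close>

text \<open>The constant \<open>24 w N / \<mu>\<close> is the fixed point of the recursion \<open>r = (1 - w \<mu> / 2) r + 12 w\<^sup>2 N\<close>.\<close>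

lemma constant_step_decay:
  fixes R :: "nat \<Rightarrow> real"
  assumes w: "0 < w" and \<mu>: "0 < \<mu>" and small: "w * \<mu> \<le> 2"
    and rec: "\<And>k. k < n \<Longrightarrow> R (Suc k) \<le> (1 - w * \<mu> / 2) * R k + 12 * w\<^sup>2 * N"
    and N: "0 \<le> N"
  shows "R n \<le> (1 - w * \<mu> / 2) ^ n * R 0 + 24 * w * N / \<mu>"
  using rec
proof (induction n)
  case 0
  then show ?case
    using w \<mu> N by simp
next
  case (Suc n)
  let ?q = "1 - w * \<mu> / 2"
  have "R (Suc n) \<le> ?q * R n + 12 * w\<^sup>2 * N"
    using Suc.prems by simp
  also have "\<dots> \<le> ?q * (?q ^ n * R 0 + 24 * w * N / \<mu>) + 12 * w\<^sup>2 * N"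
    using Suc small by (intro add_right_mono mult_left_mono) auto
  also have "\<dots> = ?q ^ Suc n * R 0 + 24 * w * N / \<mu>"
    using \<mu> by (simp add: field_simps power2_eq_square)
  finally show ?case .
qed

text \<open>The step size solves \<open>1 - w \<mu> / 2 = k\<^sup>2 / (k + 1)\<^sup>2\<close>, and it satisfies \<open>(k + 1) w \<le> 4 / \<mu>\<close>, so the
  rescaled noise \<open>12 (k + 1)\<^sup>2 w\<^sup>2 N\<close> is at most \<open>192 N / \<mu>\<^sup>2\<close>.\<close>

lemma decreasing_step_decay:
  fixes R :: "nat \<Rightarrow> real"
  assumes \<mu>: "0 < \<mu>" and N: "0 \<le> N"
    and w: "w = (2 * real k + 1) / (real k + 1)\<^sup>2 * (2 / \<mu>)"
    and rec: "R (Suc k) \<le> (1 - w * \<mu> / 2) * R k + 12 * w\<^sup>2 * N"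
  shows "(real (Suc k))\<^sup>2 * R (Suc k) \<le> (real k)\<^sup>2 * R k + 192 * N / \<mu>\<^sup>2"
proof -
  define m where "m = real k + 1"
  have m: "0 < m" "real (Suc k) = m" "real k = m - 1"
    by (auto simp: m_def)
  have w': "w = (2 * m - 1) / m\<^sup>2 * (2 / \<mu>)"
    unfolding w m_def by simp
  have q: "m\<^sup>2 * (1 - w * \<mu> / 2) = (real k)\<^sup>2"
    unfolding w' m(3) using m(1) \<mu> by (simp add: field_simps power2_eq_square)
  have "m * w * \<mu> = 4 - 2 / m"
    unfolding w' using m \<mu> by (simp add: field_simps power2_eq_square)
  then have "m * w * \<mu> \<le> 4"
    using m(1) by simp
  then have "m * w \<le> 4 / \<mu>"
    using \<mu> by (simp add: field_simps)
  moreover have "0 \<le> m * w"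
    using m(1) \<mu> unfolding w by (intro mult_nonneg_nonneg divide_nonneg_nonneg) auto
  ultimately have "(m * w)\<^sup>2 \<le> (4 / \<mu>)\<^sup>2"
    by (rule power_mono)
  then have noise: "12 * (m * w)\<^sup>2 * N \<le> 12 * (4 / \<mu>)\<^sup>2 * N"
    using N by (intro mult_right_mono mult_left_mono) auto
  have "m\<^sup>2 * R (Suc k) \<le> m\<^sup>2 * ((1 - w * \<mu> / 2) * R k + 12 * w\<^sup>2 * N)"
    by (rule mult_left_mono[OF rec]) simp
  also have "\<dots> = (m\<^sup>2 * (1 - w * \<mu> / 2)) * R k + 12 * (m * w)\<^sup>2 * N"
    by (simp add: algebra_simps power_mult_distrib)
  also have "\<dots> \<le> (real k)\<^sup>2 * R k + 192 * N / \<mu>\<^sup>2"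
    using noise unfolding q by (simp add: power_divide)
  finally show ?thesis
    by (simp add: m)
qed

text \<open>The quantity controlled is \<open>K\<^sup>2 R K\<close>. The constant phase is followed up to index \<open>ks + 1\<close>, since
  step \<open>ks\<close> still uses the constant step size; from there the decreasing phase adds
  \<open>192 N / \<mu>\<^sup>2\<close> per step. The choice of \<open>ks\<close> puts \<open>ks w \<mu>\<close> between \<open>4\<close> and \<open>4 + w \<mu>\<close>: the lower bound gives
  the factor \<open>exp (-2)\<close>, the upper bound keeps the noise floor of the constant phase below
  \<open>192 N / (\<mu>\<^sup>2 K)\<close> at the switch.\<close>

lemma switching_rate:
  fixes R \<eta> :: "nat \<Rightarrow> real"
  assumes w: "0 < w" and \<mu>: "0 < \<mu>" and small: "w * \<mu> \<le> 1 / 4" and N: "0 \<le> N"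
    and R0: "0 \<le> R 0"
    and ks: "4 / (\<mu> * w) \<le> real ks" "real ks < 4 / (\<mu> * w) + 1"
    and \<eta>: "\<And>k. \<eta> k = (if k \<le> ks then w else (2 * real k + 1) / (real k + 1)\<^sup>2 * (2 / \<mu>))"
    and rec: "\<And>k. R (Suc k) \<le> (1 - \<eta> k * \<mu> / 2) * R k + 12 * (\<eta> k)\<^sup>2 * N"
    and K: "ks \<le> K"
  shows "R K \<le> (real ks / real K)\<^sup>2 * (R 0 / exp 2) + 192 * N / (\<mu>\<^sup>2 * real K)"
proof -
  define q where "q = 1 - w * \<mu> / 2"
  define r where "r = real ks"
  have r: "4 \<le> r * (w * \<mu>)" "r * (w * \<mu>) \<le> 4 + w * \<mu>"
    using ks w \<mu> unfolding r_def by (auto simp: field_simps)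
  have "0 < r"
    using r(1) w \<mu> by (metis less_eq_real_def less_le_trans mult_pos_pos zero_less_mult_pos2 zero_less_numeral)
  have q: "0 \<le> q" "q \<le> 1"
    using small w \<mu> unfolding q_def by (auto simp: mult_nonneg_nonneg)
  have "q \<le> exp (- (w * \<mu> / 2))"
    using exp_ge_add_one_self[of "- (w * \<mu> / 2)"] by (simp add: q_def)
  then have "q ^ ks \<le> exp (- (w * \<mu> / 2)) ^ ks"
    by (rule power_mono) (rule q(1))
  also have "\<dots> = exp (- (r * (w * \<mu>) / 2))"
    unfolding r_def by (simp add: exp_of_nat_mult[symmetric])
  also have "\<dots> \<le> 1 / exp 2"
    using r(1) by (simp add: exp_minus[symmetric] inverse_eq_divide[symmetric])
  finally have decay: "q ^ ks \<le> 1 / exp 2" .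
  have constant_phase: "R n \<le> q ^ n * R 0 + 24 * w * N / \<mu>" if "n \<le> Suc ks" for n
    unfolding q_def
  proof (rule constant_step_decay[OF w \<mu> _ _ N])
    show "R (Suc k) \<le> (1 - w * \<mu> / 2) * R k + 12 * w\<^sup>2 * N" if "k < n" for k
      using rec[of k] \<eta>[of k] that \<open>n \<le> Suc ks\<close> by simp
  qed (use small in simp)
  have scaled_noise: "m\<^sup>2 * (24 * w * N / \<mu>) \<le> 192 * N / \<mu>\<^sup>2 * m" if "0 \<le> m" "m * (w * \<mu>) \<le> 8" for m
  proof -
    have "m\<^sup>2 * (24 * w * N / \<mu>) = 24 * N / \<mu>\<^sup>2 * m * (m * (w * \<mu>))"
      using \<mu> by (simp add: field_simps power2_eq_square)
    also have "\<dots> \<le> 24 * N / \<mu>\<^sup>2 * m * 8"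
      using that N by (intro mult_left_mono) auto
    finally show ?thesis
      by simp
  qed
  have bound: "(real K)\<^sup>2 * R K \<le> r\<^sup>2 * (R 0 / exp 2) + 192 * N / \<mu>\<^sup>2 * real K"
    if "ks \<le> K" for K
  proof (cases "K = ks")
    case True
    have "r\<^sup>2 * R ks \<le> r\<^sup>2 * (R 0 / exp 2 + 24 * w * N / \<mu>)"
      using constant_phase[of ks] mult_right_mono[OF decay R0] by (intro mult_left_mono) auto
    then show ?thesis
      using scaled_noise[of r] r \<open>0 < r\<close> small True by (simp add: r_def algebra_simps)
  next
    case False
    with that have "Suc ks \<le> K"
      by simp
    then show ?thesis
    proof (induction K rule: dec_induct)
      case base
      \<comment> \<open>The extra constant step, from \<open>ks\<close> to \<open>ks + 1\<close>, contracts at least as much as the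
        decreasing step would at that index.\<close>
      have "(r + 1)\<^sup>2 * q \<le> r\<^sup>2"
      proof -
        have "(r + 1)\<^sup>2 * (w * \<mu>) = r * (r * (w * \<mu>)) + 2 * (r * (w * \<mu>)) + w * \<mu>"
          by (simp add: algebra_simps power2_eq_square)
        moreover have "r * 4 \<le> r * (r * (w * \<mu>))"
          using r(1) \<open>0 < r\<close> by (intro mult_left_mono) auto
        ultimately have "4 * r + 2 \<le> (r + 1)\<^sup>2 * (w * \<mu>)"
          using r(1) w \<mu> by (smt (verit) mult_pos_pos)
        then show ?thesis
          unfolding q_def by (simp add: algebra_simps power2_eq_square)
      qed
      then have "(r + 1)\<^sup>2 * q * q ^ ks \<le> r\<^sup>2 * (1 / exp 2)"
        using decay q(1) by (intro mult_mono) auto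
      then have init: "(r + 1)\<^sup>2 * q ^ Suc ks * R 0 \<le> r\<^sup>2 * (R 0 / exp 2)"
        using mult_right_mono[OF _ R0] by (fastforce simp: mult.assoc)
      have "(r + 1)\<^sup>2 * R (Suc ks) \<le> (r + 1)\<^sup>2 * (q ^ Suc ks * R 0 + 24 * w * N / \<mu>)"
        by (rule mult_left_mono[OF constant_phase]) auto
      also have "\<dots> = (r + 1)\<^sup>2 * q ^ Suc ks * R 0 + (r + 1)\<^sup>2 * (24 * w * N / \<mu>)"
        by (simp add: algebra_simps)
      also have "\<dots> \<le> r\<^sup>2 * (R 0 / exp 2) + 192 * N / \<mu>\<^sup>2 * (r + 1)"
        using r \<open>0 < r\<close> small by (intro add_mono init scaled_noise) (auto simp: algebra_simps)
      finally show ?case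
        by (simp add: r_def add.commute)
    next
      case (step k)
      then have "\<eta> k = (2 * real k + 1) / (real k + 1)\<^sup>2 * (2 / \<mu>)"
        using \<eta> by simp
      from decreasing_step_decay[OF \<mu> N this rec] step.IH show ?case
        by (simp add: algebra_simps add_divide_distrib)
    qed
  qed
  have "0 < real K"
    using K \<open>0 < r\<close> unfolding r_def by linarith
  have "R K = (real K)\<^sup>2 * R K / (real K)\<^sup>2"
    using \<open>0 < real K\<close> by simp
  also have "\<dots> \<le> (r\<^sup>2 * (R 0 / exp 2) + 192 * N / \<mu>\<^sup>2 * real K) / (real K)\<^sup>2"
    by (rule divide_right_mono[OF bound[OF K]]) simp
  also have "\<dots> = (r / real K)\<^sup>2 * (R 0 / exp 2) + 192 * N / (\<mu>\<^sup>2 * real K)"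
    using \<open>0 < real K\<close> \<mu> by (simp add: field_simps power2_eq_square)
  finally show ?thesis
    by (simp add: r_def)
qed

lemma (in expected_residual_problem) k_star_bounds:
  "4 / (\<mu> * omega_bar L \<mu> \<delta>) \<le> real (k_star L \<mu> \<delta>)"
  "real (k_star L \<mu> \<delta>) < 4 / (\<mu> * omega_bar L \<mu> \<delta>) + 1"
proof -
  have "0 < 4 / (\<mu> * omega_bar L \<mu> \<delta>)"
    using mu_pos omega_bar_pos by simp
  then show "4 / (\<mu> * omega_bar L \<mu> \<delta>) \<le> real (k_star L \<mu> \<delta>)"
    "real (k_star L \<mu> \<delta>) < 4 / (\<mu> * omega_bar L \<mu> \<delta>) + 1"
    unfolding k_star_def by linarith+
qed

text \<open>The decreasing step is below \<open>4 / (\<mu> (k + 1))\<close>, which is at most \<open>omega_bar\<close> once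
  \<open>k + 1\<close> exceeds \<open>4 / (\<mu> omega_bar)\<close>, that is, from the switch on.\<close>

lemma (in expected_residual_problem) switching_step_bounds:
  "0 < switching_step L \<mu> \<delta> k" "switching_step L \<mu> \<delta> k \<le> omega_bar L \<mu> \<delta>"
proof -
  let ?w = "omega_bar L \<mu> \<delta>"
  show "0 < switching_step L \<mu> \<delta> k"
    using omega_bar_pos mu_pos unfolding switching_step_def by simp
  show "switching_step L \<mu> \<delta> k \<le> ?w"
  proof (cases "k \<le> k_star L \<mu> \<delta>")
    case False
    define m where "m = real k + 1"
    have "4 / (\<mu> * ?w) \<le> m" "0 < m"
      using k_star_bounds(1) False unfolding m_def by linarith+
    then have "4 / (\<mu> * m) \<le> ?w"
      using mu_pos omega_bar_pos by (simp add: field_simps)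
    moreover have "(2 * m - 1) / m\<^sup>2 * (2 / \<mu>) \<le> 2 * m / m\<^sup>2 * (2 / \<mu>)"
      using \<open>0 < m\<close> mu_pos by (intro mult_right_mono divide_right_mono) auto
    moreover have "2 * m / m\<^sup>2 * (2 / \<mu>) = 4 / (\<mu> * m)"
      using \<open>0 < m\<close> mu_pos by (simp add: field_simps power2_eq_square)
    moreover have "switching_step L \<mu> \<delta> k = (2 * m - 1) / m\<^sup>2 * (2 / \<mu>)"
      using False by (simp add: switching_step_def m_def)
    ultimately show ?thesis
      by linarith
  qed (simp add: switching_step_def)
qed

theorem theorem2p2:
  fixes Fs :: "'n::finite \<Rightarrow> real^'d \<Rightarrow> real^'d"
    and D :: "(real^'n) measure"
    and M :: "'w measure"
    and v :: "int \<Rightarrow> 'w \<Rightarrow> real^'n"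
    and x0 xs :: "real^'d"
    and L \<mu> \<delta> :: real
    and \<gamma> \<omega> :: "nat \<Rightarrow> real"
    and K :: nat
  assumes meas: "\<And>i. Fs i \<in> borel_measurable borel"
    and lipschitz: "L-lipschitz_on UNIV (mean_op Fs)"
    and qsm: "quasi_strongly_monotone \<mu> (mean_op Fs) xs"
    and samp: "sampling_distribution D"
    and delta_pos: "0 < \<delta>"
    and ER: "expected_residual \<delta> D Fs xs"
    and sigma_finite: "integrable D (\<lambda>w. (norm (sampled_op Fs w xs))\<^sup>2)"
    and prob: "prob_space M"
    and indep: "prob_space.indep_vars M (\<lambda>_. borel) v {-1..}"
    and distr: "\<And>k. -1 \<le> k \<Longrightarrow> distr M borel (v k) = D"
    and gamma_def: "\<gamma> = switching_step L \<mu> \<delta>"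
    and omega_def: "\<omega> = switching_step L \<mu> \<delta>"
    and K_ge: "k_star L \<mu> \<delta> \<le> K"
  shows "integrable M (speg_error Fs \<gamma> \<omega> x0 xs v K) \<and>
    speg_R2 M Fs \<gamma> \<omega> x0 xs v K
      \<le> (real (k_star L \<mu> \<delta>) / real K)\<^sup>2 * (speg_R2 M Fs \<gamma> \<omega> x0 xs v 0 / exp 2)
        + 192 * sigma_star2 D Fs xs / (\<mu>\<^sup>2 * real K)"
proof -
  interpret problem: expected_residual_problem Fs D xs L \<mu> \<delta>
    using meas lipschitz qsm samp delta_pos ER sigma_finite by unfold_locales auto
  interpret prob_space M
    by (rule prob)
  interpret run: speg_run Fs D xs L \<mu> \<delta> M v x0 "switching_step L \<mu> \<delta>"
    using indep distr problem.switching_step_bounds by unfold_locales auto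
  show ?thesis
    unfolding gamma_def omega_def
    using run.err_integrable
      switching_rate[where R = run.R2 and \<eta> = "switching_step L \<mu> \<delta>", OF problem.omega_bar_pos problem.mu_pos
        problem.step_size_bounds(3)[OF problem.omega_bar_pos order_refl] problem.sigma_nonneg
        run.R2_nonneg problem.k_star_bounds switching_step_def run.one_step_recursion K_ge]
    by blast
qed

end
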